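(* Let $0<c<r$ be real numbers, let $\gamma=c/r$ and $\delta=r-c$, and let $k\ge 1$ be an integer. Let $f_k(c)$ be the maximum completion rate, over all partitions of a task of cost $c$ and reward $r$ into $k$ steps of costs $c_1,\dots,c_k\ge 0$ with $c_1+\dots+c_k=c$. Then the maximum is attained and $$f_k(c)=(1-\gamma)^{1/k}.$$ Moreover, in the optimal partition the cost of the first step is $$x_k^*(c)=\delta^{(k-1)/k}r^{1/k}-\delta,$$ and the bottleneck values of all $k$ steps are the same, equal to $1-f_k(c)$.
   Context: There is a continuum of agents, with present-bias parameter $\beta$ uniformly distributed on $[0,1]$. The steps are performed in the order $1,\dots,k$, and the reward $r$ is received after the last step. An agent with parameter $\beta$ who has completed steps $1,\dots,i-1$ performs step $i$ if and only if $c_i+\beta\sum_{j>i}c_j\le \beta r$; otherwise it quits. The completion rate of a partition $(c_1,\dots,c_k)$ is the fraction of agents (Lebesgue measure of the set of $\beta\in[0,1]$) who complete all $k$ steps. The bottleneck value of step $i$ is the minimum $\beta\in[0,1]$ for which $c_i+\beta\sum_{j>i}c_j\le\beta r$. The optimal partition is a partition $(c_1,\dots,c_k)$ maximizing the completion rate. *)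

theory Defs
  imports "HOL-Analysis.Analysis"
begin

text \<open>
  A partition \<open>(c_1, \<dots>, c_k)\<close> is the list \<open>cs\<close> of its costs, in the order in which the steps
  are performed. List positions start at 0, so \<open>cs ! i\<close> is the cost of step \<open>i + 1\<close> and
  \<open>drop (Suc i) cs\<close> lists the costs of all later steps.
\<close>

definition partitions :: "nat \<Rightarrow> real \<Rightarrow> real list set" where
  "partitions k c = {cs. length cs = k \<and> (\<forall>x\<in>set cs. 0 \<le> x) \<and> sum_list cs = c}"

definition willing :: "real \<Rightarrow> real list \<Rightarrow> real \<Rightarrow> nat \<Rightarrow> bool" where
  "willing r cs \<beta> i \<longleftrightarrow> cs ! i + \<beta> * sum_list (drop (Suc i) cs) \<le> \<beta> * r"

primrec completes_first :: "real \<Rightarrow> real list \<Rightarrow> real \<Rightarrow> nat \<Rightarrow> bool" where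
  "completes_first r cs \<beta> 0 \<longleftrightarrow> True"
| "completes_first r cs \<beta> (Suc i) \<longleftrightarrow> completes_first r cs \<beta> i \<and> willing r cs \<beta> i"

definition completion_rate :: "real \<Rightarrow> real list \<Rightarrow> real" where
  "completion_rate r cs = measure lebesgue {\<beta> \<in> {0..1}. completes_first r cs \<beta> (length cs)}"

text \<open>A relation rather than a \<open>LEAST\<close> term, so that it asserts that the minimum exists.\<close>

definition is_bottleneck_value :: "real \<Rightarrow> real list \<Rightarrow> nat \<Rightarrow> real \<Rightarrow> bool" where
  "is_bottleneck_value r cs i b \<longleftrightarrow>
     b \<in> {0..1} \<and> willing r cs b i \<and> (\<forall>\<beta>\<in>{0..1}. willing r cs \<beta> i \<longrightarrow> b \<le> \<beta>)"

definition optimal_partition :: "nat \<Rightarrow> real \<Rightarrow> real \<Rightarrow> real list \<Rightarrow> bool" where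
  "optimal_partition k c r cs \<longleftrightarrow>
     cs \<in> partitions k c \<and> (\<forall>ds\<in>partitions k c. completion_rate r ds \<le> completion_rate r cs)"

text \<open>
  \<open>f_k(c)\<close> as a supremum; it is the maximum whenever an optimal partition exists.
\<close>

definition max_completion_rate :: "nat \<Rightarrow> real \<Rightarrow> real \<Rightarrow> real" where
  "max_completion_rate k c r = (SUP cs\<in>partitions k c. completion_rate r cs)"

end

(* Let R_i be the reward minus the cost of the steps not yet done after i steps, so that R_0 = r - c
   and R_k = r. Step i + 1 costs R_(i+1) - R_i, and an agent performs it iff
   1 - \<beta> \<le> R_i / R_(i+1). Hence the completion rate is the minimum of these k ratios. Their
   product telescopes to (r - c) / r = 1 - \<gamma>, so the minimum is at most the k-th root of
   1 - \<gamma>, with equality iff all ratios are equal. *)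

theory Submission
  imports Defs
begin

section \<open>Products whose factors share a lower bound\<close>

lemma min_power_le_prod:
  fixes f :: "'a \<Rightarrow> real"
  assumes "finite A" and "0 \<le> q" and "\<And>i. i \<in> A \<Longrightarrow> q \<le> f i"
  shows "q ^ card A \<le> prod f A"
proof -
  have "(\<Prod>i\<in>A. q) \<le> prod f A"
    using assms by (intro prod_mono) auto
  then show ?thesis by simp
qed

text \<open>A single factor above \<open>q\<close> would push the product strictly past
  \<open>q ^ card A\<close>, since the other factors contribute at least
  \<open>q ^ (card A - 1)\<close>, which is positive. This yields the equality case of the
  bound.\<close>

lemma power_eq_prod_imp_eq:
  fixes f :: "'a \<Rightarrow> real"
  assumes "finite A" and "0 < q" and "\<And>i. i \<in> A \<Longrightarrow> q \<le> f i"
    and "prod f A = q ^ card A" and "j \<in> A"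
  shows "f j = q"
proof (rule ccontr)
  assume "f j \<noteq> q"
  with assms have "q < f j" by force
  have "q ^ card A = q * q ^ card (A - {j})"
    using assms(1,5) by (metis card.remove power_Suc)
  also have "\<dots> < f j * q ^ card (A - {j})"
    using \<open>q < f j\<close> assms(2) by (intro mult_strict_right_mono) auto
  also have "\<dots> \<le> f j * prod f (A - {j})"
    using \<open>q < f j\<close> assms by (intro mult_left_mono min_power_le_prod) auto
  also have "\<dots> = prod f A"
    using assms(1,5) by (simp add: prod.remove)
  finally show False using assms(4) by simp
qed

section \<open>Surpluses, their ratios, and the completion rate as the least ratio\<close>

definition surplus :: "real \<Rightarrow> real list \<Rightarrow> nat \<Rightarrow> real" where
  "surplus r cs i = r - sum_list (drop i cs)"

definition surplus_ratio :: "real \<Rightarrow> real list \<Rightarrow> nat \<Rightarrow> real" where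
  "surplus_ratio r cs i = surplus r cs i / surplus r cs (Suc i)"

lemma nth_eq_surplus_diff:
  "i < length cs \<Longrightarrow> cs ! i = surplus r cs (Suc i) - surplus r cs i"
  by (simp add: surplus_def flip: Cons_nth_drop_Suc)

lemma partition_length: "cs \<in> partitions k c \<Longrightarrow> length cs = k"
  by (simp add: partitions_def)

lemma surplus_start: "cs \<in> partitions k c \<Longrightarrow> surplus r cs 0 = r - c"
  by (simp add: partitions_def surplus_def)

lemma surplus_end: "cs \<in> partitions k c \<Longrightarrow> surplus r cs k = r"
  by (simp add: partitions_def surplus_def)

text \<open>The steps before \<open>i\<close> cost at least 0, so the remaining ones cost at most
  \<open>c\<close>, which is below \<open>r\<close>. Past the end \<open>drop\<close> gives the
  empty list and the surplus is \<open>r\<close>. Hence every ratio has a positive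
  denominator.\<close>

lemma surplus_pos:
  assumes "cs \<in> partitions k c" and "c < r"
  shows "0 < surplus r cs i"
proof -
  have "0 \<le> sum_list (take i cs)"
    using assms(1) by (intro sum_list_nonneg) (auto simp: partitions_def dest: in_set_takeD)
  moreover have "sum_list (take i cs) + sum_list (drop i cs) = c"
    using assms(1) by (simp add: partitions_def flip: sum_list_append)
  ultimately show ?thesis using assms(2) by (simp add: surplus_def)
qed

lemma surplus_ratio_pos:
  assumes "cs \<in> partitions k c" and "c < r"
  shows "0 < surplus_ratio r cs i"
  using surplus_pos[OF assms] by (simp add: surplus_ratio_def)

lemma surplus_ratio_le_1:
  assumes "cs \<in> partitions k c" and "c < r" and "i < k"
  shows "surplus_ratio r cs i \<le> 1"
proof -
  have "i < length cs" and "0 \<le> cs ! i"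
    using assms by (auto simp: partitions_def)
  then have "surplus r cs i \<le> surplus r cs (Suc i)"
    using nth_eq_surplus_diff[of i cs r] by simp
  then show ?thesis
    using surplus_pos[OF assms(1,2)] by (simp add: surplus_ratio_def)
qed

lemma prod_surplus_ratio:
  assumes "cs \<in> partitions k c" and "c < r"
  shows "(\<Prod>i<k. surplus_ratio r cs i) = (r - c) / r"
proof -
  have "(\<Prod>i<n. surplus_ratio r cs i) = surplus r cs 0 / surplus r cs n" for n
    using surplus_pos[OF assms] by (induction n) (simp_all add: surplus_ratio_def less_imp_neq[symmetric])
  then show ?thesis
    using assms(1) by (simp add: surplus_start surplus_end)
qed

lemma willing_iff:
  assumes "cs \<in> partitions k c" and "c < r" and "i < k"
  shows "willing r cs \<beta> i \<longleftrightarrow> 1 - \<beta> \<le> surplus_ratio r cs i"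
proof -
  have "willing r cs \<beta> i \<longleftrightarrow> cs ! i \<le> \<beta> * surplus r cs (Suc i)"
    by (auto simp: willing_def surplus_def algebra_simps)
  \<comment> \<open>The cost of the step is replaced by the difference of the surpluses on either
    side of it.\<close>
  also have "\<dots> \<longleftrightarrow> (1 - \<beta>) * surplus r cs (Suc i) \<le> surplus r cs i"
    using assms by (auto simp: nth_eq_surplus_diff[of i cs r] partition_length algebra_simps)
  also have "\<dots> \<longleftrightarrow> 1 - \<beta> \<le> surplus_ratio r cs i"
    using surplus_pos[OF assms(1,2)] by (simp add: surplus_ratio_def pos_le_divide_eq)
  finally show ?thesis .
qed

lemma completes_first_iff:
  "completes_first r cs \<beta> n \<longleftrightarrow> (\<forall>i<n. willing r cs \<beta> i)"
  by (induction n) (auto simp: less_Suc_eq)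

text \<open>Each step asks that \<beta> be at least 1 minus its ratio. The agents meeting all these
  thresholds form the interval from \<open>1 - ?M\<close> to 1, whose length is the least ratio
  \<open>?M\<close>.\<close>

lemma completion_rate_eq_Min:
  assumes "cs \<in> partitions k c" and "c < r" and "1 \<le> k"
  shows "completion_rate r cs = (MIN i\<in>{..<k}. surplus_ratio r cs i)"
proof -
  let ?M = "MIN i\<in>{..<k}. surplus_ratio r cs i"
  have ne: "{..<k} \<noteq> {}" using assms(3) by (auto simp: lessThan_empty_iff)
  have le_M: "x \<le> ?M \<longleftrightarrow> (\<forall>i<k. x \<le> surplus_ratio r cs i)" for x
    using Min_ge_iff[of "surplus_ratio r cs ` {..<k}" x] ne by (simp add: lessThan_def)
  \<comment> \<open>\<open>M0\<close> makes the length of the interval equal to \<open>?M\<close>;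
    \<open>M1\<close> below keeps the interval inside [0,1].\<close>
  have M0: "0 \<le> ?M"
    unfolding le_M using surplus_ratio_pos[OF assms(1,2)] by (simp add: less_imp_le)
  have "?M \<le> surplus_ratio r cs 0"
    using assms(3) by (intro Min_le) auto
  also have "\<dots> \<le> 1"
    using assms by (intro surplus_ratio_le_1[OF assms(1,2)]) simp
  finally have M1: "?M \<le> 1" .
  have "completes_first r cs \<beta> (length cs) \<longleftrightarrow> 1 - \<beta> \<le> ?M" for \<beta>
    unfolding le_M completes_first_iff
    using assms(1,2) by (simp add: willing_iff partition_length)
  then have "\<beta> \<in> {0..1} \<and> completes_first r cs \<beta> (length cs) \<longleftrightarrow> \<beta> \<in> {1 - ?M..1}" for \<beta>
    using M1 by (simp only: atLeastAtMost_iff) linarith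
  then have "{\<beta> \<in> {0..1}. completes_first r cs \<beta> (length cs)} = {1 - ?M..1}"
    by blast
  then show ?thesis
    using M0 by (simp add: completion_rate_def)
qed

section \<open>The optimal rate \<open>q\<close> and the partitions that attain it\<close>

context
  fixes k :: nat and c r q :: real
  assumes cr: "0 < c" "c < r" and k: "1 \<le> k"
    and q_def: "q = ((r - c) / r) powr (1 / real k)"
begin

lemma root_pos: "0 < q"
  using cr by (simp add: q_def)

lemma root_power: "q ^ k = (r - c) / r"
proof -
  have "q ^ k = q powr real k"
    using root_pos by (simp add: powr_realpow)
  then show ?thesis
    using cr k by (simp add: q_def powr_powr)
qed

lemma root_le_1: "q \<le> 1"
  using cr k by (simp add: q_def powr_le1)

lemma completion_rate_le:
  assumes "cs \<in> partitions k c"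
  shows "completion_rate r cs \<le> q"
proof -
  have nonneg: "0 \<le> completion_rate r cs"
    by (simp add: completion_rate_def)
  have "completion_rate r cs ^ card {..<k} \<le> (\<Prod>i<k. surplus_ratio r cs i)"
    using nonneg
    by (intro min_power_le_prod) (auto simp: completion_rate_eq_Min[OF assms cr(2) k])
  then have "completion_rate r cs ^ k \<le> q ^ k"
    by (simp add: prod_surplus_ratio[OF assms cr(2)] root_power)
  then show ?thesis
    using nonneg root_pos k by simp
qed

text \<open>The rate is the least ratio, so no ratio is below \<open>q\<close>; their product is
  exactly \<open>q ^ k\<close>, which leaves no room for a larger one.\<close>

lemma surplus_ratio_eq_root:
  assumes "cs \<in> partitions k c" and "completion_rate r cs = q" and "i < k"
  shows "surplus_ratio r cs i = q"
proof (rule power_eq_prod_imp_eq[of "{..<k}"])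
  fix j assume "j \<in> {..<k}"
  then show "q \<le> surplus_ratio r cs j"
    using completion_rate_eq_Min[OF assms(1) cr(2) k] assms(2) by simp
qed (use assms(3) root_pos in
      \<open>simp_all add: prod_surplus_ratio[OF assms(1) cr(2)] root_power\<close>)

lemma completion_rate_root_attained:
  obtains cs where "cs \<in> partitions k c" and "completion_rate r cs = q"
proof
  \<comment> \<open>Solving R_i = q R_(i+1) backwards from R_k = r gives R_i = r q^(k-i); the costs
    are the successive differences.\<close>
  define cs where "cs = map (\<lambda>i. r * q ^ (k - Suc i) - r * q ^ (k - i)) [0..<k]"
  have sum: "sum_list (drop i cs) = r - r * q ^ (k - i)" if "i \<le> k" for i
    using that
  \<comment> \<open>The induction descends from \<open>k\<close>, because the suffix at
    \<open>i\<close> adds one entry to the suffix at \<open>Suc i\<close>.\<close>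
  proof (induction rule: inc_induct)
    case base
    then show ?case by (simp add: cs_def)
  next
    case (step i)
    then have "i < length cs"
      by (simp add: cs_def)
    then have "drop i cs = cs ! i # drop (Suc i) cs"
      by (rule Cons_nth_drop_Suc[symmetric])
    with step show ?case by (simp add: cs_def)
  qed
  have "0 \<le> x" if "x \<in> set cs" for x
  proof -
    from that obtain i where "i < k" and x: "x = r * q ^ (k - Suc i) - r * q ^ (k - i)"
      by (auto simp: cs_def)
    have "q ^ (k - i) \<le> q ^ (k - Suc i)"
      using root_pos root_le_1 by (intro power_decreasing) auto
    then show ?thesis using cr by (simp add: x)
  qed
  \<comment> \<open>The whole list sums to r - r q^k, and r q^k = r - c.\<close>
  moreover have "sum_list cs = c"
    using sum[of 0] cr by (simp add: root_power field_simps)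
  ultimately show cs: "cs \<in> partitions k c"
    by (simp add: partitions_def cs_def)
  have "surplus_ratio r cs i = q" if "i < k" for i
  proof -
    have "k - i = Suc (k - Suc i)" using that by simp
    then show ?thesis
      using that cr root_pos by (simp add: surplus_ratio_def surplus_def sum)
  qed
  then have "surplus_ratio r cs ` {..<k} = (\<lambda>_. q) ` {..<k}"
    by (intro image_cong) simp_all
  also have "\<dots> = {q}"
    using k by (simp add: image_constant_conv lessThan_empty_iff)
  finally show "completion_rate r cs = q"
    by (simp add: completion_rate_eq_Min[OF cs cr(2) k])
qed

text \<open>The upper bound \<open>q\<close> is attained, so maximality becomes an equation that
  applies to every optimal partition, not only to the one constructed.\<close>

lemma optimal_partition_iff:
  "optimal_partition k c r cs \<longleftrightarrow> cs \<in> partitions k c \<and> completion_rate r cs = q"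
  using completion_rate_root_attained completion_rate_le
  by (metis optimal_partition_def order_antisym)

lemma max_completion_rate_eq: "max_completion_rate k c r = q"
proof -
  obtain cs where cs: "cs \<in> partitions k c" "completion_rate r cs = q"
    by (rule completion_rate_root_attained)
  show ?thesis
    unfolding max_completion_rate_def
    by (rule cSup_eq_maximum) (use cs completion_rate_le in auto)
qed

lemma optimal_first_cost:
  assumes "optimal_partition k c r cs"
  shows "cs ! 0 = (r - c) powr ((real k - 1) / real k) * r powr (1 / real k) - (r - c)"
proof -
  have cs: "cs \<in> partitions k c" and rate: "completion_rate r cs = q"
    using assms by (auto simp: optimal_partition_iff)
  have "(r - c) / surplus r cs (Suc 0) = q"
    using surplus_ratio_eq_root[OF cs rate, of 0] k cs
    by (simp add: surplus_ratio_def surplus_start)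
  then have "surplus r cs (Suc 0) = (r - c) / q"
    using surplus_pos[OF cs cr(2), of "Suc 0"] root_pos by (simp add: field_simps)
  moreover have "(real k - 1) / real k = 1 - 1 / real k"
    using k by (simp add: field_simps)
  \<comment> \<open>Dividing \<delta> by (\<delta>/r)^(1/k) leaves \<delta>^(1-1/k) r^(1/k), the
    surplus after the first step.\<close>
  then have "(r - c) / q = (r - c) powr ((real k - 1) / real k) * r powr (1 / real k)"
    using cr by (simp add: q_def powr_divide powr_diff)
  ultimately show ?thesis
    using nth_eq_surplus_diff[of 0 cs r] cs k by (simp add: partition_length surplus_start)
qed

text \<open>All ratios equal \<open>q\<close>, so every step has the same threshold
  \<open>1 - q\<close>, which lies in [0,1] and itself passes the test.\<close>

lemma optimal_bottleneck:
  assumes "optimal_partition k c r cs" and "i < k"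
  shows "is_bottleneck_value r cs i (1 - q)"
proof -
  have cs: "cs \<in> partitions k c" and rate: "completion_rate r cs = q"
    using assms by (auto simp: optimal_partition_iff)
  have "willing r cs \<beta> i \<longleftrightarrow> 1 - \<beta> \<le> q" for \<beta>
    using willing_iff[OF cs cr(2) assms(2)] surplus_ratio_eq_root[OF cs rate assms(2)] by simp
  then show ?thesis
    using root_pos root_le_1 by (auto simp: is_bottleneck_value_def)
qed

end

theorem mainTheorem7:
  fixes c r \<gamma> \<delta> :: real and k :: nat
  assumes "0 < c" and "c < r"
    and "\<gamma> = c / r" and "\<delta> = r - c"
    and "1 \<le> k"
  shows "(\<exists>cs. optimal_partition k c r cs) \<and>
    max_completion_rate k c r = (1 - \<gamma>) powr (1 / real k) \<and>
    (\<forall>cs. optimal_partition k c r cs \<longrightarrow>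
      cs ! 0 = \<delta> powr ((real k - 1) / real k) * r powr (1 / real k) - \<delta> \<and>
      (\<forall>i<k. is_bottleneck_value r cs i (1 - max_completion_rate k c r)))"
proof -
  have "1 - \<gamma> = (r - c) / r"
    using assms by (simp add: field_simps)
  \<comment> \<open>\<open>refl\<close> discharges \<open>q_def\<close>, so that \<open>q\<close>
    becomes the power itself.\<close>
  moreover note hyps = assms(1,2,5) refl
  have "\<exists>cs. optimal_partition k c r cs"
    using completion_rate_root_attained[OF hyps] optimal_partition_iff[OF hyps] by metis
  ultimately show ?thesis
    using optimal_first_cost[OF hyps] optimal_bottleneck[OF hyps] max_completion_rate_eq[OF hyps]
    by (simp add: assms(4))
qed

end
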